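(* There are infinitely many binary words that are simultaneously extremal overlap-free, irreducible overlap-free, and delicate overlap-free.
   Context: Words are finite strings over the binary alphabet $\{0,1\}$. A factor of a word is a contiguous subword. An overlap is a word of the form $xYxYx$ where $x$ is a letter and $Y$ is a (possibly empty) word; a word is overlap-free if none of its factors is an overlap. An extremal overlap-free word is an overlap-free word $w$ such that for every factorization $w = uv$ (with $u$ or $v$ possibly empty) and every letter $a\in\{0,1\}$, the word $uav$ contains an overlap. A letter of a word is interior if it is neither the first nor the last letter. An irreducible overlap-free word is an overlap-free word of length at least $3$ such that removing any one of its interior letters yields a word containing an overlap. A delicate overlap-free word is a nonempty overlap-free word such that changing any single one of its letters to the other letter yields a word containing an overlap. *)

theory Defs
  imports Main "HOL-Library.Sublist"
begin

text \<open>Binary words are boolean lists: \<^const>\<open>False\<close> is the letter 0 and \<^const>\<open>True\<close> is the letter 1,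
  so negation exchanges the two letters. Factors are given by \<^const>\<open>sublist\<close>, which is
  the contiguous notion (as opposed to \<^const>\<open>subseq\<close>).\<close>

type_synonym binary_word = "bool list"

definition is_overlap :: "'a list \<Rightarrow> bool" where
  "is_overlap w \<longleftrightarrow> (\<exists>x Y. w = [x] @ Y @ [x] @ Y @ [x])"

definition contains_overlap :: "'a list \<Rightarrow> bool" where
  "contains_overlap w \<longleftrightarrow> (\<exists>z. sublist z w \<and> is_overlap z)"

definition overlap_free :: "'a list \<Rightarrow> bool" where
  "overlap_free w \<longleftrightarrow> \<not> contains_overlap w"

definition extremal_overlap_free :: "binary_word \<Rightarrow> bool" where
  "extremal_overlap_free w \<longleftrightarrow>
     overlap_free w \<and> (\<forall>u v a. w = u @ v \<longrightarrow> contains_overlap (u @ [a] @ v))"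

definition irreducible_overlap_free :: "binary_word \<Rightarrow> bool" where
  "irreducible_overlap_free w \<longleftrightarrow>
     overlap_free w \<and> length w \<ge> 3 \<and>
     (\<forall>u a v. w = u @ [a] @ v \<and> u \<noteq> [] \<and> v \<noteq> [] \<longrightarrow> contains_overlap (u @ v))"

definition delicate_overlap_free :: "binary_word \<Rightarrow> bool" where
  "delicate_overlap_free w \<longleftrightarrow>
     overlap_free w \<and> w \<noteq> [] \<and>
     (\<forall>u a v. w = u @ [a] @ v \<longrightarrow> contains_overlap (u @ [\<not> a] @ v))"

end

theory Submission
  imports Defs
begin

text \<open>
  Let \<open>\<mu>\<close> be the Thue--Morse morphism. The words \<open>\<mu>\<^sup>2\<^sup>n(00110011)\<close> with \<open>n \<ge> 2\<close> have all three
  properties. They are overlap-free because \<open>\<mu>\<close> preserves overlap-freeness. They are concatenations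
  of blocks \<open>0110\<close> and \<open>1001\<close>, and an edit inside a block already creates an overlap within
  three consecutive blocks, which is a finite check. Only the insertions at the two ends need long
  overlaps: \<open>\<mu>\<^sup>2\<^sup>n(0)\<mu>\<^sup>2\<^sup>n(0)\<close> and the whole word are squares that are prefixes and end in
  different letters, so prepending either letter completes one of them to an overlap; the
  right end is symmetric.
\<close>

section \<open>Overlaps as factors of length \<open>2 * p + 1\<close> with period \<open>p\<close>,
  and a decision procedure for them\<close>

lemma contains_overlap_iff_nth:
  "contains_overlap w \<longleftrightarrow>
    (\<exists>i p. 0 < p \<and> i + 2 * p < length w \<and> (\<forall>j\<le>p. w ! (i + j) = w ! (i + p + j)))"
proof
  assume "contains_overlap w"
  then obtain u v x Y where w: "w = u @ ([x] @ Y @ [x] @ Y @ [x]) @ v"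
    unfolding contains_overlap_def is_overlap_def sublist_def by blast
  let ?A = "[x] @ Y @ [x]"
  have "w ! (length u + j) = w ! (length u + Suc (length Y) + j)" if "j \<le> Suc (length Y)" for j
  proof -
    \<comment> \<open>The overlap \<open>xYxYx\<close> holds two copies of \<open>xYx\<close>
      sharing the middle \<open>x\<close>; the second starts one period after the first.\<close>
    have "w = u @ ?A @ (Y @ [x] @ v)" "w = (u @ [x] @ Y) @ ?A @ v"
      by (simp_all add: w)
    moreover have "(L @ ?A @ R) ! (length L + j) = ?A ! j" for L R
      using that by (simp only: nth_append_length_plus) (simp only: nth_append, simp)
    ultimately show ?thesis
      by (metis add_Suc_right length_append length_Cons append_Cons append_Nil)
  qed
  then show "\<exists>i p. 0 < p \<and> i + 2 * p < length w \<and> (\<forall>j\<le>p. w ! (i + j) = w ! (i + p + j))"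
    by (intro exI[of _ "length u"] exI[of _ "Suc (length Y)"]) (auto simp: w)
next
  assume "\<exists>i p. 0 < p \<and> i + 2 * p < length w \<and> (\<forall>j\<le>p. w ! (i + j) = w ! (i + p + j))"
  then obtain i p where p: "0 < p" and len: "i + 2 * p < length w"
    and per: "\<And>j. j \<le> p \<Longrightarrow> w ! (i + j) = w ! (i + p + j)"
    by blast
  let ?z = "take (2 * p + 1) (drop i w)"
  define w' where "w' = drop i w"
  have w': "2 * p < length w'" "\<And>m. w' ! m = w ! (i + m)"
    using len by (auto simp: w'_def)
  then obtain x Y where xY: "take p w' = x # Y"
    using p by (cases "take p w'") auto
  then have "w' ! 0 = x"
    using p by (metis nth_Cons_0 nth_take)
  \<comment> \<open>Two periods are chained here: \<open>j = 0\<close> links positions 0 and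
    \<open>p\<close>, and \<open>j = p\<close> links \<open>p\<close> and
    \<open>2 * p\<close>.\<close>
  moreover have "w' ! (2 * p) = w' ! 0"
    using per[of 0] per[of p] w'(2) by (simp add: mult_2 add.assoc)
  moreover have "take p (drop p w') = take p w'"
    using w' per by (intro nth_equalityI) (auto simp: add.assoc)
  moreover have "take (2 * p + 1) w' = take p w' @ take p (drop p w') @ [w' ! (2 * p)]"
    using w'(1) by (simp add: take_Suc_conv_app_nth mult_2 take_add)
  ultimately have "?z = [x] @ Y @ [x] @ Y @ [x]"
    by (simp add: xY flip: w'_def)
  moreover have "sublist ?z w"
    by (metis append_take_drop_id sublist_def)
  ultimately show "contains_overlap w"
    unfolding contains_overlap_def is_overlap_def by blast
qed

text \<open>A decision procedure by structural recursion: \<open>square_prefix u w\<close> asks for an overlap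
  \<open>xYxYx\<close> that is a prefix of \<open>u @ w\<close> with \<open>u\<close> a prefix of \<open>xY\<close>.\<close>

fun square_prefix :: "'a list \<Rightarrow> 'a list \<Rightarrow> bool" where
  "square_prefix u [] = False"
| "square_prefix u (x # w) \<longleftrightarrow>
    (case u of [] \<Rightarrow> False | y # _ \<Rightarrow> prefix (u @ [y]) (x # w)) \<or> square_prefix (u @ [x]) w"

fun has_overlap :: "'a list \<Rightarrow> bool" where
  "has_overlap [] = False"
| "has_overlap (x # w) \<longleftrightarrow> square_prefix [] (x # w) \<or> has_overlap w"

text \<open>Here \<open>v\<close> is the part of the first copy of \<open>xY\<close> still to be
  read. If it is empty, the \<open>prefix\<close> test decides; otherwise its first letter moves
  into the accumulator \<open>u\<close>.\<close>

lemma square_prefix_iff: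
  "square_prefix u w \<longleftrightarrow> (\<exists>v x Y r. u @ v = x # Y \<and> w = v @ (x # Y) @ x # r)"
proof (induction u w rule: square_prefix.induct)
  case (2 u x w)
  have "(\<exists>v y Y r. u @ v = y # Y \<and> x # w = v @ (y # Y) @ y # r) \<longleftrightarrow>
      (\<exists>y Y r. u = y # Y \<and> x # w = (y # Y) @ y # r) \<or>
      (\<exists>v y Y r. u @ x # v = y # Y \<and> w = v @ (y # Y) @ y # r)" (is "?A \<longleftrightarrow> ?B \<or> ?C")
  proof
    assume ?A
    then obtain v y Y r where v: "u @ v = y # Y" "x # w = v @ (y # Y) @ y # r" by blast
    show "?B \<or> ?C"
    proof (cases v)
      case Nil
      then show ?thesis using v by auto
    next
      case (Cons z v')
      then have "u @ x # v' = y # Y" "w = v' @ (y # Y) @ y # r" using v by auto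
      then show ?thesis by blast
    qed
  next
    assume "?B \<or> ?C"
    then show ?A
    proof
      assume ?B
      then show ?A by (metis append.right_neutral append_Nil)
    next
      assume ?C
      then obtain v y Y r where "u @ x # v = y # Y" "w = v @ (y # Y) @ y # r" by blast
      then have "u @ (x # v) = y # Y \<and> x # w = (x # v) @ (y # Y) @ y # r" by simp
      then show ?A by blast
    qed
  qed
  moreover have "(case u of [] \<Rightarrow> False | y # _ \<Rightarrow> prefix (u @ [y]) (x # w)) \<longleftrightarrow> ?B"
    by (cases u) (auto simp: prefix_def)
  ultimately show ?case using 2 by simp
qed auto

text \<open>Read from right to left, this makes \<open>contains_overlap\<close> executable on
  concrete words.\<close>

lemma has_overlap_iff: "has_overlap w \<longleftrightarrow> contains_overlap w"
proof -
  have step: "(\<exists>u t. x # w = u @ t \<and> P t) \<longleftrightarrow> P (x # w) \<or> (\<exists>u t. w = u @ t \<and> P t)"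
    for x :: 'a and w and P
    by (auto simp: Cons_eq_append_conv)
  have "has_overlap w \<longleftrightarrow> (\<exists>u t. w = u @ t \<and> square_prefix [] t)"
    by (induction w) (simp_all only: has_overlap.simps step, simp)
  also have "\<dots> \<longleftrightarrow> (\<exists>u x Y r. w = u @ ([x] @ Y @ [x] @ Y @ [x]) @ r)"
    by (simp add: square_prefix_iff) blast
  also have "\<dots> \<longleftrightarrow> contains_overlap w"
    unfolding contains_overlap_def is_overlap_def sublist_def by blast
  finally show ?thesis .
qed

lemma contains_overlap_sublist: "contains_overlap v \<Longrightarrow> contains_overlap (u @ v @ w)"
  unfolding contains_overlap_def sublist_def by (metis append.assoc)

lemma contains_overlap_Cons_square:
  assumes "X \<noteq> []" "last X = a"
  shows "contains_overlap (a # X @ X)"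
proof -
  from assms have "a # X @ X = [a] @ butlast X @ [a] @ butlast X @ [a]"
    by (metis append.assoc append_Cons append_Nil append_butlast_last_id)
  then show ?thesis
    unfolding contains_overlap_def is_overlap_def by blast
qed

lemma contains_overlap_square_snoc:
  assumes "X \<noteq> []" "hd X = a"
  shows "contains_overlap (X @ X @ [a])"
proof -
  from assms have "X @ X @ [a] = [a] @ tl X @ [a] @ tl X @ [a]"
    by (cases X) auto
  then show ?thesis
    unfolding contains_overlap_def is_overlap_def by blast
qed

section \<open>The Thue--Morse morphism\<close>

fun tm :: "bool list \<Rightarrow> bool list" where
  "tm [] = []"
| "tm (x # xs) = x # (\<not> x) # tm xs"

lemma length_tm [simp]: "length (tm w) = 2 * length w"
  by (induction w) auto

lemma tm_append [simp]: "tm (u @ v) = tm u @ tm v"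
  by (induction u) auto

lemma nth_tm: "k < length w \<Longrightarrow> tm w ! (2 * k) = w ! k \<and> tm w ! Suc (2 * k) = (\<not> w ! k)"
proof (induction w arbitrary: k)
  case (Cons x w)
  then show ?case by (cases k) auto
qed simp

text \<open>An even period in \<open>tm w\<close> descends to an overlap of \<open>w\<close> with
  half the period; an odd one is incompatible with the blocks 01 and 10.\<close>

lemma overlap_free_tm:
  assumes "overlap_free w"
  shows "overlap_free (tm w)"
  unfolding overlap_free_def
proof
  assume "contains_overlap (tm w)"
  then obtain i p where p: "0 < p" and len: "i + 2 * p < 2 * length w"
    and per: "\<And>j. j \<le> p \<Longrightarrow> tm w ! (i + j) = tm w ! (i + p + j)"
    unfolding contains_overlap_iff_nth by auto
  have flip: "tm w ! Suc m = (\<not> tm w ! m)" if "even m" "m < 2 * length w" for m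
    using that nth_tm[of "m div 2" w] by auto
  show False
  proof (cases "even p")
    case True
    then obtain q where q: "p = 2 * q" by blast
    \<comment> \<open>\<open>k\<close> is the letter of \<open>w\<close> whose block contains
      position \<open>i\<close>. For odd \<open>i\<close> the second letters of blocks are compared,
      which are the negations of the first ones.\<close>
    define k where "k = i div 2"
    have "w ! (k + j) = w ! (k + q + j)" if j: "j \<le> q" for j
    proof (cases "even i")
      case True
      then have "i = 2 * k" by (simp add: k_def)
      then show ?thesis
        using per[of "2 * j"] nth_tm[of "k + j" w] nth_tm[of "k + q + j" w] len j q
        by (simp add: algebra_simps)
    next
      case False
      then have "i = Suc (2 * k)" by (simp add: k_def)
      then show ?thesis
        using per[of "2 * j"] nth_tm[of "k + j" w] nth_tm[of "k + q + j" w] len j q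
        by (simp add: algebra_simps)
    qed
    moreover have "0 < q" "k + 2 * q < length w"
      using p len q by (auto simp: k_def)
    ultimately show False
      using assms unfolding overlap_free_def contains_overlap_iff_nth by blast
  next
    case False
    \<comment> \<open>An odd period carries the block boundaries to odd positions, so that \<open>tm w\<close>
      alternates along a whole period, which is impossible since the period is odd.\<close>
    have step: "tm w ! Suc (i + j) = (\<not> tm w ! (i + j))" if "j < p" for j
    proof (cases "even (i + j)")
      case True
      then show ?thesis using flip len that by simp
    next
      case odd: False
      then have "tm w ! Suc (i + p + j) = (\<not> tm w ! (i + p + j))"
        using flip[of "i + p + j"] False len that by auto
      then show ?thesis using per[of j] per[of "Suc j"] that by simp
    qed
    have "j \<le> p \<Longrightarrow> tm w ! (i + j) = (tm w ! i \<noteq> odd j)" for j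
      by (induction j) (auto simp: step)
    from this[of p] show False using per[of 0] False by simp
  qed
qed

section \<open>Local edits\<close>

text \<open>One operation covers all three properties: \<open>d = 0\<close> inserts,
  \<open>d = 1\<close> with \<open>x = []\<close> deletes, and \<open>d = 1\<close> with one letter
  substitutes.\<close>

definition edit :: "nat \<Rightarrow> nat \<Rightarrow> 'a list \<Rightarrow> 'a list \<Rightarrow> 'a list" where
  "edit i d x w = take i w @ x @ drop (i + d) w"

lemma edit_append:
  "j + d \<le> length M \<Longrightarrow> edit (length L + j) d x (L @ M @ R) = L @ edit j d x M @ R"
  by (simp add: edit_def)

text \<open>Each letter of \<open>U\<close> becomes a block of four letters, so three letters from
  index \<open>k\<close> on occupy 12 positions from \<open>4 * k\<close> on. An overlap created in
  that factor persists in the whole word.\<close>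

lemma tm_tm_window:
  assumes "k + 3 \<le> length U" "j + d \<le> 12"
    and "contains_overlap (edit j d x (tm (tm (take 3 (drop k U)))))"
  shows "contains_overlap (edit (4 * k + j) d x (tm (tm U)))"
proof -
  let ?L = "tm (tm (take k U))" and ?M = "tm (tm (take 3 (drop k U)))"
    and ?R = "tm (tm (drop (k + 3) U))"
  have "U = take k U @ take 3 (drop k U) @ drop (k + 3) U"
    by (metis add.commute append_take_drop_id drop_drop)
  then have "tm (tm U) = ?L @ ?M @ ?R"
    by (metis tm_append)
  moreover have "length ?L = 4 * k" "length ?M = 12"
    using assms(1) by auto
  ultimately show ?thesis
    using edit_append[of j d ?M ?L x ?R] assms(2,3) contains_overlap_sublist by metis
qed

definition edits_overlap :: "nat \<Rightarrow> bool list \<Rightarrow> bool" where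
  "edits_overlap i w \<longleftrightarrow>
    (\<forall>a. contains_overlap (edit i 0 [a] w)) \<and>
    contains_overlap (edit i 1 [] w) \<and>
    contains_overlap (edit i 1 [\<not> w ! i] w)"

text \<open>The six triples are all binary words of length 3 except the overlaps 000 and 111, and
  positions 4 to 7 form the middle block. The other two checks concern the first and the last block
  of the word, which have a neighbour on one side only.\<close>

lemma edits_overlap_check:
  "list_all (\<lambda>X. list_all (\<lambda>j. edits_overlap j (tm (tm X))) [4, 5, 6, 7])
    [[False, False, True], [False, True, False], [False, True, True],
     [True, False, False], [True, False, True], [True, True, False]]"
  "list_all (\<lambda>j. edits_overlap j (tm (tm [False, True, True]))) [2, 3]"
  "list_all (\<lambda>j. edits_overlap j (tm (tm [False, False, True]))) [8, 9, 10]"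
  unfolding edits_overlap_def has_overlap_iff[symmetric] by code_simp+

text \<open>These are the edits at the first two positions and the last one that a window can
  settle. The insertions left over amount to prepending or appending a letter.\<close>

lemma end_edits_check:
  "contains_overlap (edit 0 1 [True] (tm (tm [False, True, True])))"
  "contains_overlap (edit 1 0 [True] (tm (tm [False, True, True])))"
  "contains_overlap (edit 1 1 [] (tm (tm [False, True, True])))"
  "contains_overlap (edit 1 1 [False] (tm (tm [False, True, True])))"
  "contains_overlap (edit 11 0 [False] (tm (tm [False, False, True])))"
  "contains_overlap (edit 11 1 [False] (tm (tm [False, False, True])))"
  unfolding has_overlap_iff[symmetric] by code_simp+

lemma edits_overlap_inner:
  assumes "overlap_free X" "length X = 3" "4 \<le> j" "j < 8"
  shows "edits_overlap j (tm (tm X))"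
proof -
  obtain x y z where X: "X = [x, y, z]"
    using assms(2) by (auto simp: numeral_3_eq_3 length_Suc_conv)
  have "\<not> (x = y \<and> y = z)"
    using assms(1) by (auto simp: X overlap_free_def has_overlap_iff[symmetric])
  moreover have "j \<in> {4, 5, 6, 7}"
    using assms(3,4) by auto
  ultimately show ?thesis
    using edits_overlap_check(1) unfolding X by (cases x; cases y; cases z) auto
qed

lemma nth_tm_tm_window:
  assumes "k + 3 \<le> length U" "j < 12"
  shows "tm (tm U) ! (4 * k + j) = tm (tm (take 3 (drop k U))) ! j"
proof -
  have "U = take k U @ take 3 (drop k U) @ drop (k + 3) U"
    by (metis add.commute append_take_drop_id drop_drop)
  then have "tm (tm U) = tm (tm (take k U)) @ tm (tm (take 3 (drop k U))) @ tm (tm (drop (k + 3) U))"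
    by (metis tm_append)
  moreover have "length (tm (tm (take k U))) = 4 * k"
    using assms(1) by simp
  ultimately show ?thesis
    using assms by (simp add: nth_append)
qed

lemma edits_overlap_window:
  assumes "k + 3 \<le> length U" "j < 12" "edits_overlap j (tm (tm (take 3 (drop k U))))"
  shows "edits_overlap (4 * k + j) (tm (tm U))"
  using assms(3) tm_tm_window[OF assms(1)] assms(2) nth_tm_tm_window[OF assms(1,2)]
  by (simp add: edits_overlap_def)

lemma overlap_free_window: "overlap_free w \<Longrightarrow> overlap_free (take m (drop k w))"
  unfolding overlap_free_def
  by (metis append_take_drop_id contains_overlap_sublist)

lemma edits_overlap_tm_tm:
  assumes free: "overlap_free U" and len: "3 \<le> length U"
    and left: "take 3 U = [False, True, True]"
    and right: "drop (length U - 3) U = [False, False, True]"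
    and i: "2 \<le> i" "Suc i < 4 * length U"
  shows "edits_overlap i (tm (tm U))"
proof -
  consider "i < 4" | "4 \<le> i" "i < 4 * length U - 4" | "4 * length U - 4 \<le> i"
    by linarith
  then show ?thesis
  proof cases
    case 1
    then have "i \<in> {2, 3}" using i by auto
    then show ?thesis
      using edits_overlap_window[of 0 U i] edits_overlap_check(2) len left by auto
  next
    case 2
    \<comment> \<open>The window starts one letter before the block containing \<open>i\<close>,
      which thus becomes its middle block.\<close>
    define k where "k = i div 4 - 1"
    have "1 \<le> i div 4" "4 * (i div 4) + i mod 4 = i"
      using 2 by auto
    then have "4 * k + (4 + i mod 4) = i" "k + 3 \<le> length U"
      using 2 unfolding k_def by linarith+
    moreover have "edits_overlap (4 + i mod 4) (tm (tm (take 3 (drop k U))))"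
      using edits_overlap_inner[OF overlap_free_window[OF free]] \<open>k + 3 \<le> length U\<close> by auto
    ultimately show ?thesis
      using edits_overlap_window[of k U "4 + i mod 4"] by simp
  next
    case 3
    define j where "j = i - 4 * (length U - 3)"
    have "i = 4 * (length U - 3) + j" "j \<in> {8, 9, 10}"
      using 3 i len unfolding j_def by auto
    then show ?thesis
      using edits_overlap_window[of "length U - 3" U j] edits_overlap_check(3) len right by auto
  qed
qed

text \<open>This reduces the three properties to the shape of the ends of \<open>U\<close> and to
  the two global facts \<open>prepend\<close> and \<open>append\<close>; every other edit is settled
  inside a window.\<close>

lemma extremal_irreducible_delicate_tm_tm:
  assumes free: "overlap_free U" and len: "3 \<le> length U"
    and left: "take 3 U = [False, True, True]"
    and right: "drop (length U - 3) U = [False, False, True]"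
    and prepend: "\<And>a. contains_overlap (a # tm (tm U))"
    and append: "\<And>a. contains_overlap (tm (tm U) @ [a])"
  defines "W \<equiv> tm (tm U)"
  shows "extremal_overlap_free W \<and> irreducible_overlap_free W \<and> delicate_overlap_free W"
proof -
  have lenW: "length W = 4 * length U" by (simp add: W_def)
  have freeW: "overlap_free W" unfolding W_def by (intro overlap_free_tm free)
  have inner: "edits_overlap i W" if "2 \<le> i" "Suc i < length W" for i
    using edits_overlap_tm_tm[OF free len left right] that by (simp add: W_def)
  have leftW: "contains_overlap (edit j d x W)"
    if "contains_overlap (edit j d x (tm (tm [False, True, True])))" "j + d \<le> 12" for j d x
    using tm_tm_window[of 0 U j d x] that len left by (simp add: W_def)
  have rightW: "contains_overlap (edit (length W - 1) d x W)"
    if "contains_overlap (edit 11 d x (tm (tm [False, False, True])))" "d \<le> 1" for d x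
  proof -
    have "length W - 1 = 4 * (length U - 3) + 11"
      using len lenW by linarith
    then show ?thesis
      using tm_tm_window[of "length U - 3" U 11 d x] that len right by (simp add: W_def)
  qed
  have "W ! j = tm (tm [False, True, True]) ! j" if "j < 12" for j
    using nth_tm_tm_window[of 0 U j] that len left by (simp add: W_def)
  from this[of 0] this[of 1] have W01: "\<not> W ! 0" "W ! 1" by simp_all
  have Wlast: "W ! (length W - 1)"
  proof -
    have "length W - 1 = 4 * (length U - 3) + 11"
      using len lenW by linarith
    then show ?thesis
      using nth_tm_tm_window[of "length U - 3" U 11] len right by (simp add: W_def)
  qed
  have "contains_overlap (u @ [a] @ v)" if uv: "W = u @ v" for u v a
  proof -
    have e: "u @ [a] @ v = edit (length u) 0 [a] W"
      by (simp add: uv edit_def)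
    consider "u = []" | "v = []" | "length u = 1" | "length v = 1"
      | "2 \<le> length u" "Suc (length u) < length W"
      using lenW len uv by (cases u; cases v) (force simp: Suc_le_eq)+
    then show ?thesis
    proof cases
      case 3
      then have u: "u = [False]"
        using W01(1) uv by (cases u) auto
      show ?thesis
      proof (cases a)
        case True
        then show ?thesis using e u leftW end_edits_check(2) by simp
      next
        case False
        \<comment> \<open>Inserting 0 just after the initial 0 gives the same word as prepending
          0.\<close>
        then show ?thesis using prepend[of a] u uv by (simp add: W_def[symmetric])
      qed
    next
      case 4
      then have v: "v = [True]"
        using Wlast uv by (cases v) auto
      show ?thesis
      proof (cases a)
        case True
        \<comment> \<open>Likewise, inserting 1 just before the final 1 gives the same word as
          appending 1.\<close>
        then show ?thesis using append[of a] v uv by (simp add: W_def[symmetric])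
      next
        case False
        have "length u = length W - 1" using uv v by simp
        then show ?thesis
          using False e rightW[of 0 "[False]"] end_edits_check(5) by simp
      qed
    next
      case 1
      then show ?thesis using prepend[of a] uv by (simp add: W_def[symmetric])
    next
      case 2
      then show ?thesis using append[of a] uv by (simp add: W_def[symmetric])
    next
      case 5
      then show ?thesis using e inner by (simp add: edits_overlap_def)
    qed
  qed
  then have "extremal_overlap_free W"
    unfolding extremal_overlap_free_def using freeW by blast
  moreover have "contains_overlap (u @ v)" if "W = u @ [a] @ v" "u \<noteq> []" "v \<noteq> []" for u v a
  proof -
    have e: "u @ v = edit (length u) 1 [] W"
      by (simp add: that edit_def)
    have "0 < length u" "Suc (length u) < length W"
      using that by auto
    then consider "length u = 1" | "2 \<le> length u" "Suc (length u) < length W"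
      by linarith
    then show ?thesis
      by cases (use e leftW end_edits_check(3) inner in \<open>auto simp: edits_overlap_def\<close>)
  qed
  then have "irreducible_overlap_free W"
    unfolding irreducible_overlap_free_def using freeW lenW len by auto
  moreover have "contains_overlap (u @ [\<not> a] @ v)" if "W = u @ [a] @ v" for u v a
  proof -
    have e: "u @ [\<not> a] @ v = edit (length u) 1 [\<not> W ! length u] W"
      by (simp add: that edit_def)
    have "length u < length W"
      using that by simp
    then consider "length u = 0" | "length u = 1" | "length u = length W - 1"
      | "2 \<le> length u" "Suc (length u) < length W"
      by linarith
    then show ?thesis
    proof cases
      case 1
      then show ?thesis using e W01 leftW[OF end_edits_check(1)] by simp
    next
      case 2
      then show ?thesis using e W01 leftW[OF end_edits_check(4)] by simp
    next
      case 3
      then show ?thesis using e Wlast rightW[OF end_edits_check(6)] by simp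
    next
      case 4
      then show ?thesis using e inner by (simp add: edits_overlap_def)
    qed
  qed
  then have "delicate_overlap_free W"
    unfolding delicate_overlap_free_def using freeW lenW len by auto
  ultimately show ?thesis by blast
qed

section \<open>The family of words\<close>

text \<open>The step is the square of \<open>tm\<close> because its blocks 0110 and 1001 begin and
  end with the letter they encode, whereas a single \<open>tm\<close> flips the last letter.\<close>

definition tm_pow4 :: "nat \<Rightarrow> bool list \<Rightarrow> bool list" where
  "tm_pow4 n w = ((\<lambda>w. tm (tm w)) ^^ n) w"

lemma tm_pow4_0 [simp]: "tm_pow4 0 w = w"
  and tm_pow4_Suc: "tm_pow4 (Suc n) w = tm (tm (tm_pow4 n w))"
  by (simp_all add: tm_pow4_def)

lemma tm_pow4_append: "tm_pow4 n (u @ v) = tm_pow4 n u @ tm_pow4 n v"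
  by (induction n) (simp_all add: tm_pow4_Suc)

lemma length_tm_pow4: "length (tm_pow4 n w) = 4 ^ n * length w"
  by (induction n) (simp_all add: tm_pow4_Suc)

lemma overlap_free_tm_pow4: "overlap_free w \<Longrightarrow> overlap_free (tm_pow4 n w)"
  by (induction n) (simp_all add: tm_pow4_Suc overlap_free_tm)

lemma tm_pow4_singleton:
  shows "\<exists>w. tm_pow4 n [x] = x # w" and "\<exists>w. tm_pow4 n [x] = w @ [x]"
proof -
  show "\<exists>w. tm_pow4 n [x] = x # w"
    by (induction n) (auto simp: tm_pow4_Suc)
  show "\<exists>w. tm_pow4 n [x] = w @ [x]"
  proof (induction n)
    case (Suc n)
    then obtain w where "tm_pow4 n [x] = w @ [x]" by blast
    then have "tm_pow4 (Suc n) [x] = (tm (tm w) @ [x, \<not> x, \<not> x]) @ [x]"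
      by (simp add: tm_pow4_Suc)
    then show ?case by blast
  qed simp
qed

definition seed :: "bool list" where
  "seed = [False, False, True, True, False, False, True, True]"

text \<open>These factorizations exhibit the squares that serve the two ends: the prefix 00, the
  suffix 11, and the whole word with root 0011.\<close>

lemma seed_eq:
  "seed = [False] @ [False] @ [True, True, False, False, True, True]"
  "seed = [False, False, True, True, False, False] @ [True] @ [True]"
  "seed = [False, False, True, True] @ [False, False, True, True]"
  by (simp_all add: seed_def)

lemma overlap_free_seed: "overlap_free seed"
  unfolding overlap_free_def has_overlap_iff[symmetric] seed_def by code_simp

lemma tm_pow4_seed_ends:
  "\<exists>w. tm_pow4 n seed = False # w" "\<exists>w. tm_pow4 n seed = w @ [True]"
proof -
  have "seed = [False] @ tl seed" "seed = butlast seed @ [True]"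
    by (simp_all add: seed_def)
  then show "\<exists>w. tm_pow4 n seed = False # w" "\<exists>w. tm_pow4 n seed = w @ [True]"
    using tm_pow4_singleton[of n] tm_pow4_append[of n]
    by (metis append_Cons, metis append_assoc)
qed

lemma prepend_tm_pow4_seed: "contains_overlap (a # tm_pow4 n seed)"
proof (cases a)
  case False
  obtain w where "tm_pow4 n [False] = w @ [False]"
    using tm_pow4_singleton(2) by blast
  then have "contains_overlap (a # tm_pow4 n [False] @ tm_pow4 n [False])"
    using False by (intro contains_overlap_Cons_square) auto
  from contains_overlap_sublist[OF this, of "[]"] show ?thesis
    by (simp add: seed_eq(1) tm_pow4_append del: append.simps(2)) simp
next
  case True
  define V where "V = tm_pow4 n [False, False, True, True]"
  obtain w where w: "tm_pow4 n [True] = w @ [True]"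
    using tm_pow4_singleton(2) by blast
  have "V = tm_pow4 n [False, False, True] @ w @ [True]"
    unfolding V_def w[symmetric] tm_pow4_append[symmetric] by simp
  then have "contains_overlap (a # V @ V)"
    using True by (intro contains_overlap_Cons_square) auto
  then show ?thesis
    unfolding V_def seed_eq(3) tm_pow4_append .
qed

lemma append_tm_pow4_seed: "contains_overlap (tm_pow4 n seed @ [a])"
proof (cases a)
  case True
  obtain w where "tm_pow4 n [True] = True # w"
    using tm_pow4_singleton(1) by blast
  then have "contains_overlap (tm_pow4 n [True] @ tm_pow4 n [True] @ [a])"
    using True by (intro contains_overlap_square_snoc) auto
  from contains_overlap_sublist[OF this, of _ "[]"] show ?thesis
    unfolding seed_eq(2) tm_pow4_append by simp
next
  case False
  define V where "V = tm_pow4 n [False, False, True, True]"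
  obtain w where w: "tm_pow4 n [False] = False # w"
    using tm_pow4_singleton(1) by blast
  have "V = (False # w) @ tm_pow4 n [False, True, True]"
    unfolding V_def w[symmetric] tm_pow4_append[symmetric] by simp
  then have "contains_overlap (V @ V @ [a])"
    using False by (intro contains_overlap_square_snoc) auto
  then show ?thesis
    unfolding V_def seed_eq(3) tm_pow4_append by simp
qed

theorem theorem6:
  shows "infinite {w :: binary_word.
    extremal_overlap_free w \<and> irreducible_overlap_free w \<and> delicate_overlap_free w}"
    (is "infinite ?S")
proof -
  \<comment> \<open>The first of the two extra steps gives \<open>?U\<close> the required ends: 0110
    starts with 011 and 1001 ends with 001, while \<open>seed\<close> itself starts with 001 and
    ends with 011. The second step forms the blocks that are edited.\<close>
  have "tm_pow4 (Suc (Suc n)) seed \<in> ?S" for n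
  proof -
    let ?U = "tm_pow4 (Suc n) seed"
    obtain u v where u: "tm_pow4 n seed = False # u" and v: "tm_pow4 n seed = v @ [True]"
      using tm_pow4_seed_ends by blast
    have "?U = [False, True, True] @ False # tm (tm u)"
      by (simp add: tm_pow4_Suc u)
    moreover have "?U = (tm (tm v) @ [True]) @ [False, False, True]"
      by (simp add: tm_pow4_Suc v)
    ultimately have ends: "take 3 ?U = [False, True, True]" "3 \<le> length ?U"
      "drop (length ?U - 3) ?U = [False, False, True]"
      by (simp, simp, metis append_eq_conv_conj diff_add_inverse2 length_append
          length_Cons list.size(3) numeral_3_eq_3)
    show ?thesis
      using extremal_irreducible_delicate_tm_tm[OF overlap_free_tm_pow4[OF overlap_free_seed]
          ends(2,1,3)]
        prepend_tm_pow4_seed[of _ "Suc (Suc n)"] append_tm_pow4_seed[of "Suc (Suc n)"]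
      by (simp add: tm_pow4_Suc[of "Suc n"])
  qed
  moreover have "inj (\<lambda>n. tm_pow4 (Suc (Suc n)) seed)"
  proof (rule injI)
    fix m n
    assume "tm_pow4 (Suc (Suc m)) seed = tm_pow4 (Suc (Suc n)) seed"
    then have "length (tm_pow4 (Suc (Suc m)) seed) = length (tm_pow4 (Suc (Suc n)) seed)"
      by simp
    then show "m = n"
      by (simp add: length_tm_pow4 seed_def)
  qed
  ultimately show ?thesis
    by (metis (no_types, lifting) finite_imageD finite_subset image_subsetI infinite_UNIV_nat)
qed

end
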